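(* Let $G$ be an intersecting $3$-graph (i.e. any two edges of $G$ share at least one vertex). If $G\neq K_5^3$, then $\lambda(G)\le \lambda(K_5^3)-10^{-3}$, where $\lambda(K_5^3)=2/25$.
   Context: For an $r$-graph $G$ on $[n]$, $p_G(x)=\sum_{e\in E(G)}\prod_{i\in e}x_i$ and the lagrangian is $\lambda(G)=\max\{p_G(x): x_i\ge 0,\ \sum_{i=1}^n x_i=1\}$. $K_5^3$ is the complete $3$-graph on $5$ vertices. (Here $G\ne K_5^3$ means $G$ is not the complete $3$-graph on five vertices.)
   Formalization: "G ≠ K_5^3" is read up to isomorphism and isolated vertices: G is also assumed not to be K_5^3 with isolated vertices added, since such a graph is intersecting and has Lagrangian 2/25, which would violate the bound. *)

theory Defs
  imports "HOL-Analysis.Analysis" "HOL-Library.Ramsey"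
begin

text \<open>
  A hypergraph is given by a finite vertex set \<open>V\<close> and a set \<open>E\<close> of edges;
  \<open>[V]\<^bsup>r\<^esup>\<close> (\<open>nsets V r\<close>) is the set of all \<open>r\<close>-element subsets of \<open>V\<close>.
\<close>

definition r_graph :: "nat \<Rightarrow> 'a set \<Rightarrow> 'a set set \<Rightarrow> bool" where
  "r_graph r V E \<longleftrightarrow> finite V \<and> E \<subseteq> [V]\<^bsup>r\<^esup>"

definition intersecting :: "'a set set \<Rightarrow> bool" where
  "intersecting E \<longleftrightarrow> (\<forall>e\<in>E. \<forall>f\<in>E. e \<inter> f \<noteq> {})"

text \<open>
  Being a copy of \<open>K\<^sub>t\<^sup>r\<close> is a property of the edge set alone: vertices of the ambient vertex set
  lying in no edge are ignored. They change neither the Lagrangian nor the intersection property.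
\<close>

definition is_complete_r_graph :: "nat \<Rightarrow> nat \<Rightarrow> 'a set set \<Rightarrow> bool" where
  "is_complete_r_graph t r E \<longleftrightarrow> (\<exists>S. finite S \<and> card S = t \<and> E = [S]\<^bsup>r\<^esup>)"

definition edge_poly :: "'a set set \<Rightarrow> ('a \<Rightarrow> real) \<Rightarrow> real" where
  "edge_poly E x = (\<Sum>e\<in>E. \<Prod>i\<in>e. x i)"

text \<open>Weightings are total functions, but their values outside \<open>V\<close> are irrelevant.\<close>

definition weightings :: "'a set \<Rightarrow> ('a \<Rightarrow> real) set" where
  "weightings V = {x. (\<forall>i\<in>V. 0 \<le> x i) \<and> (\<Sum>i\<in>V. x i) = 1}"

text \<open>
  The supremum is a maximum whenever \<open>V\<close> is nonempty, see \<open>lagrangian_is_max\<close> below; for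
  \<open>V = {}\<close> there are no weightings and the value is meaningless.
\<close>

definition lagrangian :: "'a set \<Rightarrow> 'a set set \<Rightarrow> real" where
  "lagrangian V E = (SUP x\<in>weightings V. edge_poly E x)"

lemma lagrangian_is_max:
  fixes V :: "'a set"
  assumes G: "r_graph r V E" and ne: "V \<noteq> {}"
  shows "\<exists>x\<in>weightings V. edge_poly E x = lagrangian V E \<and>
           (\<forall>y\<in>weightings V. edge_poly E y \<le> edge_poly E x)"
proof -
  have fV: "finite V" and EV: "\<And>e. e \<in> E \<Longrightarrow> e \<subseteq> V"
    using G by (auto simp: r_graph_def nsets_def)
  define B :: "('a \<Rightarrow> real) set" where "B = (\<Pi>\<^sub>E i\<in>UNIV. if i \<in> V then {0..1} else {0})"
  define W where "W = B \<inter> {x. (\<Sum>i\<in>V. x i) = 1}"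
  have "compactin (product_topology (\<lambda>i. euclidean) UNIV) B"
    unfolding B_def compactin_PiE by auto
  then have "compact B"
    by (simp add: euclidean_product_topology)
  moreover have "closed {x :: 'a \<Rightarrow> real. (\<Sum>i\<in>V. x i) = 1}"
    by (intro closed_Collect_eq continuous_on_sum continuous_on_product_coordinates continuous_on_const)
  ultimately have cW: "compact W"
    unfolding W_def by (rule compact_Int_closed)
  obtain v where v: "v \<in> V" using ne by blast
  have "(\<lambda>i. if i = v then 1 else 0) \<in> W"
    using v fV by (auto simp: W_def B_def sum.delta')
  then have neW: "W \<noteq> {}" by blast
  have "continuous_on W (edge_poly E)"
    unfolding edge_poly_def
    by (intro continuous_on_sum continuous_on_prod continuous_on_subset[OF continuous_on_product_coordinates subset_UNIV])
  then obtain x where x: "x \<in> W" and mx: "\<And>y. y \<in> W \<Longrightarrow> edge_poly E y \<le> edge_poly E x"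
    using continuous_attains_sup[OF cW neW] by blast
  have xw: "x \<in> weightings V"
    using x by (fastforce simp: W_def B_def weightings_def PiE_iff split: if_splits)
  have le: "edge_poly E y \<le> edge_poly E x" if y: "y \<in> weightings V" for y
  proof -
    define z where "z = (\<lambda>i. if i \<in> V then y i else 0)"
    have "y i \<le> 1" if "i \<in> V" for i
      using member_le_sum[of i V y] that y fV by (auto simp: weightings_def)
    then have "z \<in> W"
      using y by (auto simp: z_def W_def B_def weightings_def)
    moreover have "edge_poly E z = edge_poly E y"
      unfolding edge_poly_def z_def using EV by (intro sum.cong prod.cong) auto
    ultimately show ?thesis using mx by metis
  qed
  have "lagrangian V E = edge_poly E x"
    unfolding lagrangian_def using xw le by (intro cSup_eq_maximum) auto
  with xw le show ?thesis by auto
qed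

end

theory Submission
  imports Defs
begin

text \<open>
  Let \<open>x\<close> be a maximising weighting, restricted to its support, with value \<open>p > 0.079\<close>. By first-order
  optimality every link has weight at least \<open>3p\<close>, so by Motzkin--Straus a vertex whose link is
  \<open>K\<^sub>r\<^sub>+\<^sub>1\<close>-free has weight bounded by an explicit constant (below 0.157 for \<open>r = 3\<close>, below 0.206 for
  \<open>r = 4\<close>). If \<open>C\<close> is a clique in the link of \<open>i\<close> and \<open>j\<close> lies outside \<open>C \<union> {i}\<close>, the intersection
  property forces every pair in the link of \<open>j\<close> that avoids \<open>i\<close> to contain all but at most one vertex
  of \<open>C\<close>. A \<open>K\<^sub>4\<close> then makes the link of \<open>j\<close> too light unless there are just five vertices; in that
  case the endpoints of a missing triple have \<open>K\<^sub>4\<close>-free links and the weights sum to less than 1. Without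
  \<open>K\<^sub>4\<close>, a triangle again makes the link of \<open>j\<close> too light. So all links are triangle-free and all weights
  are tiny, which is impossible because every edge meets a fixed edge.
\<close>

section \<open>Links and the edge polynomial\<close>

text \<open>For finite edges, \<open>edge_poly (link E i) x\<close> is the partial derivative of
  \<open>edge_poly E x\<close> in the variable \<open>x i\<close>.\<close>

definition link :: "'a set set \<Rightarrow> 'a \<Rightarrow> 'a set set" where
  "link E i = {f. i \<notin> f \<and> insert i f \<in> E}"

lemma nsets_finite_edges:
  assumes "finite V" "E \<subseteq> [V]\<^bsup>r\<^esup>"
  shows "finite E" "\<And>e. e \<in> E \<Longrightarrow> finite e" "\<And>e. e \<in> E \<Longrightarrow> e \<subseteq> V" "\<And>e. e \<in> E \<Longrightarrow> card e = r"
  using assms by (auto simp: nsets_def intro: finite_subset[of E "Pow V"])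

lemma link_nsets:
  assumes "E \<subseteq> [V]\<^bsup>Suc k\<^esup>"
  shows "link E i \<subseteq> [V - {i}]\<^bsup>k\<^esup>"
  using assms by (fastforce simp: link_def nsets_def)

lemma edge_poly_cong:
  assumes "\<And>e i. e \<in> E \<Longrightarrow> i \<in> e \<Longrightarrow> x i = y i"
  shows "edge_poly E x = edge_poly E y"
  unfolding edge_poly_def using assms by (intro sum.cong prod.cong) auto

lemma edge_poly_nonneg:
  assumes "\<And>e i. e \<in> E \<Longrightarrow> i \<in> e \<Longrightarrow> 0 \<le> x i"
  shows "0 \<le> edge_poly E x"
  unfolding edge_poly_def using assms by (intro sum_nonneg prod_nonneg) auto

lemma edge_poly_mono:
  assumes "finite F" "E \<subseteq> F" "\<And>e i. e \<in> F \<Longrightarrow> i \<in> e \<Longrightarrow> 0 \<le> x i"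
  shows "edge_poly E x \<le> edge_poly F x"
  unfolding edge_poly_def using assms by (intro sum_mono2 prod_nonneg) auto

lemma edge_poly_scale:
  assumes "E \<subseteq> [V]\<^bsup>k\<^esup>"
  shows "edge_poly E (\<lambda>i. c * x i) = c ^ k * edge_poly E x"
  unfolding edge_poly_def sum_distrib_left
  using assms by (intro sum.cong) (auto simp: prod.distrib nsets_def)

lemma edge_poly_singletons:
  "edge_poly ((\<lambda>u. {u}) ` N) x = sum x N"
  unfolding edge_poly_def by (subst sum.reindex) (auto simp: inj_on_def)

lemma edge_poly_link:
  assumes "finite E" "\<And>e. e \<in> E \<Longrightarrow> finite e"
  shows "x i * edge_poly (link E i) x = edge_poly {e \<in> E. i \<in> e} x"
proof -
  have "edge_poly {e \<in> E. i \<in> e} x = (\<Sum>f\<in>link E i. \<Prod>j\<in>insert i f. x j)"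
    unfolding edge_poly_def
    by (rule sum.reindex_bij_witness[where i="insert i" and j="\<lambda>e. e - {i}"])
       (auto simp: link_def insert_absorb)
  also have "\<dots> = (\<Sum>f\<in>link E i. x i * (\<Prod>j\<in>f. x j))"
  proof (rule sum.cong[OF refl])
    fix f assume "f \<in> link E i"
    then have "i \<notin> f" "finite f" using assms(2)[of "insert i f"] by (auto simp: link_def)
    then show "(\<Prod>j\<in>insert i f. x j) = x i * (\<Prod>j\<in>f. x j)" by simp
  qed
  finally show ?thesis by (simp add: edge_poly_def sum_distrib_left)
qed

lemma edge_poly_split:
  assumes "finite E"
  shows "edge_poly E x = edge_poly {e \<in> E. P e} x + edge_poly {e \<in> E. \<not> P e} x"
proof -
  have "sum g E = sum g {e \<in> E. P e} + sum g {e \<in> E. \<not> P e}" for g :: "'a set \<Rightarrow> real"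
    using sum.Int_Diff[OF assms, of g "Collect P"] by (simp add: Int_def set_diff_eq)
  then show ?thesis by (simp add: edge_poly_def)
qed

text \<open>Double counting: an edge contributes once for each of its vertices in
  \<open>A\<close>.\<close>

lemma sum_links:
  assumes "finite E" "\<And>e. e \<in> E \<Longrightarrow> finite e" "finite A"
  shows "(\<Sum>i\<in>A. x i * edge_poly (link E i) x) = (\<Sum>e\<in>E. real (card (A \<inter> e)) * (\<Prod>i\<in>e. x i))"
proof -
  have "x i * edge_poly (link E i) x = (\<Sum>e\<in>E. if i \<in> e then (\<Prod>i\<in>e. x i) else 0)" for i
  proof -
    have "x i * edge_poly (link E i) x = edge_poly {e \<in> E. i \<in> e} x"
      using assms(1,2) by (rule edge_poly_link)
    also have "\<dots> = (\<Sum>e\<in>E. if i \<in> e then (\<Prod>i\<in>e. x i) else 0)"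
      by (simp add: edge_poly_def sum.inter_filter[OF assms(1)])
    finally show ?thesis .
  qed
  then have "(\<Sum>i\<in>A. x i * edge_poly (link E i) x) = (\<Sum>i\<in>A. \<Sum>e\<in>E. if i \<in> e then (\<Prod>i\<in>e. x i) else 0)"
    by simp
  also have "\<dots> = (\<Sum>e\<in>E. \<Sum>i\<in>A. if i \<in> e then (\<Prod>i\<in>e. x i) else 0)"
    by (rule sum.swap)
  also have "\<dots> = (\<Sum>e\<in>E. real (card (A \<inter> e)) * (\<Prod>i\<in>e. x i))"
    using assms(3) by (intro sum.cong refl) (simp add: sum.inter_restrict[symmetric])
  finally show ?thesis .
qed

lemma edge_poly_le_sum_links:
  assumes "finite E" "\<And>e. e \<in> E \<Longrightarrow> finite e" "finite A"
    and "\<And>e i. e \<in> E \<Longrightarrow> i \<in> e \<Longrightarrow> 0 \<le> x i"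
    and "\<And>e. e \<in> E \<Longrightarrow> A \<inter> e \<noteq> {}"
  shows "edge_poly E x \<le> (\<Sum>i\<in>A. x i * edge_poly (link E i) x)"
proof -
  have "edge_poly E x \<le> (\<Sum>e\<in>E. real (card (A \<inter> e)) * (\<Prod>i\<in>e. x i))"
    unfolding edge_poly_def
  proof (rule sum_mono)
    fix e assume e: "e \<in> E"
    have "1 \<le> card (A \<inter> e)"
      using assms(3) assms(5)[OF e] by (simp add: Suc_leI card_gt_0_iff)
    moreover have "0 \<le> (\<Prod>i\<in>e. x i)" using assms(4) e by (auto intro: prod_nonneg)
    ultimately show "(\<Prod>i\<in>e. x i) \<le> real (card (A \<inter> e)) * (\<Prod>i\<in>e. x i)"
      by (simp add: mult_le_cancel_right1)
  qed
  also have "\<dots> = (\<Sum>i\<in>A. x i * edge_poly (link E i) x)"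
    using assms(1-3) by (rule sum_links[symmetric])
  finally show ?thesis .
qed

section \<open>Weighted Turan bound of Motzkin and Straus\<close>

text \<open>\<open>C\<close> ranges over all finite sets of the type; \<open>clique_vertices\<close>
  places it inside the vertex set once it has two elements. For \<open>k < 2\<close> nothing is
  clique-free, since \<open>C\<close> then has no pairs.\<close>

definition clique_free :: "nat \<Rightarrow> 'a set set \<Rightarrow> bool" where
  "clique_free k E \<longleftrightarrow> (\<forall>C. finite C \<and> card C = k \<longrightarrow> \<not> [C]\<^bsup>2\<^esup> \<subseteq> E)"

lemma clique_vertices:
  assumes "E \<subseteq> [A]\<^bsup>2\<^esup>" "[C]\<^bsup>2\<^esup> \<subseteq> E" "2 \<le> card C"
  shows "C \<subseteq> A"
proof
  fix u assume u: "u \<in> C"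
  have "C \<noteq> {u}" using assms(3) by auto
  then obtain w where "w \<in> C" "w \<noteq> u" using u by blast
  then have "{u, w} \<in> [C]\<^bsup>2\<^esup>" using u by (auto simp: nsets_def)
  then have "{u, w} \<in> [A]\<^bsup>2\<^esup>" using assms(1,2) by blast
  then show "u \<in> A" by (auto simp: nsets_def)
qed

text \<open>The left side is a concave quadratic in \<open>D\<close> with maximum at
  \<open>D = s * r / (r + 1)\<close>; the gap is a multiple of a square.\<close>

lemma turan_quadratic:
  fixes s D :: real
  assumes "0 < r"
  shows "(1 - 1 / real r) / 2 * D\<^sup>2 + (s - D) * D \<le> (1 - 1 / real (Suc r)) / 2 * s\<^sup>2"
proof -
  define q where "q = real r"
  have q: "q > 0" using assms by (simp add: q_def)
  have "(1 - 1 / (q + 1)) / 2 * s\<^sup>2 - ((1 - 1 / q) / 2 * D\<^sup>2 + (s - D) * D)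
      = (q + 1) / (2 * q) * (D - s * q / (q + 1))\<^sup>2"
    using q by (simp add: divide_simps) (simp add: power2_eq_square algebra_simps)
  moreover have "0 \<le> (q + 1) / (2 * q) * (D - s * q / (q + 1))\<^sup>2"
    using q by simp
  ultimately have "(1 - 1 / q) / 2 * D\<^sup>2 + (s - D) * D \<le> (1 - 1 / (q + 1)) / 2 * s\<^sup>2" by linarith
  then show ?thesis by (simp only: q_def of_nat_Suc add.commute)
qed

text \<open>Induction on \<open>r\<close> in the style of Turan. Take a vertex \<open>v\<close> of
  maximal link weight and let \<open>N\<close> be its neighbourhood, of weight \<open>d v\<close>.
  Adding \<open>v\<close> to a clique in \<open>N\<close> enlarges it, so the induction hypothesis
  bounds the edges inside \<open>N\<close>. All other edges meet \<open>A - N\<close>, where each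
  link weighs at most \<open>d v\<close>.\<close>

theorem motzkin_straus:
  assumes "finite A" "E \<subseteq> [A]\<^bsup>2\<^esup>" "\<And>i. i \<in> A \<Longrightarrow> 0 \<le> x i"
    and "0 < r" "clique_free (Suc r) E"
  shows "edge_poly E x \<le> (1 - 1 / real r) / 2 * (sum x A)\<^sup>2"
  using assms(4,1,2,3,5)
proof (induction r arbitrary: A E rule: nat_induct_non_zero)
  case 1
  have "E = {}"
  proof (rule ccontr)
    assume "E \<noteq> {}"
    then obtain e where e: "e \<in> E" "finite e" "card e = 2"
      using 1 by (auto simp: nsets_def)
    have "f = e" if "f \<in> [e]\<^bsup>2\<^esup>" for f
      using that e card_subset_eq[of e f] by (auto simp: nsets_def)
    then have "[e]\<^bsup>2\<^esup> \<subseteq> {e}" by blast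
    then have "[e]\<^bsup>2\<^esup> \<subseteq> E" using e(1) by blast
    with e 1(4) show False by (auto simp: clique_free_def numeral_2_eq_2)
  qed
  then show ?case by (simp add: edge_poly_def)
next
  case (Suc r)
  note E = nsets_finite_edges[OF Suc.prems(1,2)]
  have x0: "0 \<le> x i" if "e \<in> E" "i \<in> e" for e i using that E Suc.prems(3) by blast
  show ?case
  proof (cases "A = {}")
    case True
    then have "E = {}" using Suc.prems(2) by (auto simp: nsets_def)
    then show ?thesis by (simp add: edge_poly_def)
  next
    case False
    define d where "d = (\<lambda>i. edge_poly (link E i) x)"
    have "Max (d ` A) \<in> d ` A" using False Suc.prems(1) by simp
    then obtain v where v: "v \<in> A" and "d v = Max (d ` A)" by auto
    then have dmax: "d u \<le> d v" if "u \<in> A" for u using that Suc.prems(1) by simp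
    define N where "N = {u. {v, u} \<in> E}"
    have NA: "N \<subseteq> A" using E(3) by (auto simp: N_def)
    have vN: "v \<notin> N" using E(4) by (fastforce simp: N_def)
    have fN: "finite N" using NA Suc.prems(1) finite_subset by blast
    have "link E v = (\<lambda>u. {u}) ` N"
    proof
      show "link E v \<subseteq> (\<lambda>u. {u}) ` N"
      proof
        fix f assume f: "f \<in> link E v"
        then have "f \<in> [A - {v}]\<^bsup>1\<^esup>"
          using link_nsets[of E A 1 v] Suc.prems(2) by (auto simp: numeral_2_eq_2)
        then obtain u where "f = {u}" by (auto simp: nsets_def card_1_singleton_iff)
        with f show "f \<in> (\<lambda>u. {u}) ` N" by (auto simp: link_def N_def)
      qed
      show "(\<lambda>u. {u}) ` N \<subseteq> link E v" using vN by (auto simp: link_def N_def)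
    qed
    then have dv: "d v = sum x N" by (simp add: d_def edge_poly_singletons)
    let ?E1 = "{e \<in> E. e \<subseteq> N}" and ?E2 = "{e \<in> E. \<not> e \<subseteq> N}"
    have "clique_free (Suc r) ?E1"
      unfolding clique_free_def
    proof safe
      fix C assume C: "finite C" "card C = Suc r" "[C]\<^bsup>2\<^esup> \<subseteq> ?E1"
      have "?E1 \<subseteq> [N]\<^bsup>2\<^esup>" using Suc.prems(2) by (auto simp: nsets_def)
      from clique_vertices[OF this C(3)] have CN: "C \<subseteq> N" using C(2) Suc.hyps by simp
      have "[insert v C]\<^bsup>2\<^esup> \<subseteq> E"
      proof
        fix e assume e: "e \<in> [insert v C]\<^bsup>2\<^esup>"
        show "e \<in> E"
        proof (cases "v \<in> e")
          case True
          have e2: "e \<subseteq> insert v C" "card e = 2" using e by (auto simp: nsets_def)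
          then have "card (e - {v}) = 1" using True by simp
          then obtain u where "e - {v} = {u}" by (rule card_1_singletonE)
          then have "u \<in> C" "e = {v, u}" using True e2(1) by auto
          then show ?thesis using CN by (auto simp: N_def)
        next
          case False
          then have "e \<in> [C]\<^bsup>2\<^esup>" using e by (auto simp: nsets_def)
          then show ?thesis using C(3) by blast
        qed
      qed
      moreover have "card (insert v C) = Suc (Suc r)" using C(1,2) vN CN by (subst card_insert_disjoint) auto
      ultimately show False using Suc.prems(4) C(1) unfolding clique_free_def by blast
    qed
    then have 1: "edge_poly ?E1 x \<le> (1 - 1 / real r) / 2 * (d v)\<^sup>2"
      unfolding dv using Suc.prems(2,3) NA fN
      by (intro Suc.IH) (auto simp: nsets_def)
    have "edge_poly ?E2 x \<le> (\<Sum>i\<in>A - N. x i * edge_poly (link ?E2 i) x)"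
    proof (rule edge_poly_le_sum_links)
      show "0 \<le> x i" if "e \<in> ?E2" "i \<in> e" for e i using that x0 by blast
      show "(A - N) \<inter> e \<noteq> {}" if "e \<in> ?E2" for e using that E(3) by blast
    qed (use E(1,2) Suc.prems(1) in auto)
    also have "\<dots> \<le> (\<Sum>i\<in>A - N. x i * d v)"
    proof (intro sum_mono mult_left_mono)
      fix i assume i: "i \<in> A - N"
      have "edge_poly (link ?E2 i) x \<le> d i"
        unfolding d_def
      proof (rule edge_poly_mono)
        show "finite (link E i)"
          using nsets_finite_edges(1)[of "A - {i}" "link E i" 1] link_nsets[of E A 1 i] Suc.prems
          by (simp add: numeral_2_eq_2)
      qed (use x0 in \<open>auto simp: link_def\<close>)
      then show "edge_poly (link ?E2 i) x \<le> d v" using dmax[of i] i by simp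
    qed (use Suc.prems(3) in auto)
    also have "\<dots> = (sum x A - d v) * d v"
      unfolding dv sum_distrib_right[symmetric] by (simp add: sum_diff[OF Suc.prems(1) NA])
    finally have "edge_poly E x \<le> (1 - 1 / real r) / 2 * (d v)\<^sup>2 + (sum x A - d v) * d v"
      using 1 edge_poly_split[OF E(1), of x "\<lambda>e. e \<subseteq> N"] by linarith
    also have "\<dots> \<le> (1 - 1 / real (Suc r)) / 2 * (sum x A)\<^sup>2"
      using Suc.hyps by (rule turan_quadratic)
    finally show ?thesis .
  qed
qed

lemma clique_free_of_card:
  assumes "finite A" "E \<subseteq> [A]\<^bsup>2\<^esup>" "card A < k" "2 \<le> k"
  shows "clique_free k E"
  unfolding clique_free_def
proof safe
  fix C assume C: "finite C" "k = card C" "[C]\<^bsup>2\<^esup> \<subseteq> E"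
  have "C \<subseteq> A" using clique_vertices C assms(2,4) by metis
  from card_mono[OF assms(1) this] show False using assms(3) C(2) by simp
qed

section \<open>First-order conditions and bounds on single weights\<close>

text \<open>One half of the Lagrange multiplier condition: by Euler's identity for homogeneous
  polynomials the multiplier is \<open>Suc k\<close> times the maximum. It is derived from a finite
  perturbation that lowers \<open>x i\<close>, hence the need for \<open>0 < x i\<close>.\<close>

lemma maximizer_link_ge:
  assumes "finite V" "E \<subseteq> [V]\<^bsup>Suc k\<^esup>" "x \<in> weightings V"
    and max: "\<And>y. y \<in> weightings V \<Longrightarrow> edge_poly E y \<le> edge_poly E x"
    and i: "i \<in> V" "0 < x i"
  shows "real (Suc k) * edge_poly E x \<le> edge_poly (link E i) x"
proof -
  note E = nsets_finite_edges[OF assms(1,2)]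
  let ?p = "edge_poly E x" and ?L = "edge_poly (link E i) x"
  have x: "\<And>j. j \<in> V \<Longrightarrow> 0 \<le> x j" "sum x V = 1" using assms(3) by (auto simp: weightings_def)
  have p0: "0 \<le> ?p" using x E(3) by (intro edge_poly_nonneg) blast
  have *: "real (Suc k) * ?p \<le> (1 + s) ^ k * ?L" if s: "0 < s" "s \<le> x i" for s
  proof -
    \<comment> \<open>Push weight away from \<open>i\<close>, rescaling so that the total stays 1.\<close>
    define y where "y = (\<lambda>j. (1 + s) * x j - (if j = i then s else 0))"
    have "0 \<le> s * x i" using s i(2) by simp
    moreover have "y i = x i + s * x i - s" by (simp add: y_def algebra_simps)
    ultimately have "0 \<le> y i" using s by linarith
    moreover have "sum y V = 1"
      using x(2) assms(1) i by (simp add: y_def sum_subtractf sum_distrib_left[symmetric])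
    ultimately have "y \<in> weightings V"
      using x s by (auto simp: weightings_def y_def)
    then have le: "edge_poly E y \<le> ?p" by (rule max)
    let ?R = "{e \<in> E. i \<notin> e}"
    have R: "?R \<subseteq> [V]\<^bsup>Suc k\<^esup>" using assms(2) by blast
    have split: "edge_poly E z = z i * edge_poly (link E i) z + edge_poly ?R z" for z
      using edge_poly_split[OF E(1), of z "\<lambda>e. i \<in> e"] edge_poly_link[OF E(1,2)] by metis
    have "edge_poly (link E i) y = edge_poly (link E i) (\<lambda>j. (1 + s) * x j)"
      by (rule edge_poly_cong) (auto simp: y_def link_def)
    also have "\<dots> = (1 + s) ^ k * ?L" by (rule edge_poly_scale[OF link_nsets[OF assms(2)]])
    finally have 1: "edge_poly (link E i) y = (1 + s) ^ k * ?L" .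
    have "edge_poly ?R y = edge_poly ?R (\<lambda>j. (1 + s) * x j)"
      by (rule edge_poly_cong) (auto simp: y_def)
    also have "\<dots> = (1 + s) ^ Suc k * edge_poly ?R x" by (rule edge_poly_scale[OF R])
    finally have "edge_poly E y = (1 + s) ^ Suc k * ?p - s * ((1 + s) ^ k * ?L)"
      using 1 split[of y] split[of x] by (simp add: y_def algebra_simps)
    with le have "(1 + s) ^ Suc k * ?p - ?p \<le> s * ((1 + s) ^ k * ?L)" by simp
    \<comment> \<open>Bernoulli's inequality bounds the gain from rescaling from below by a multiple
      of \<open>s\<close>, so that \<open>s\<close> cancels.\<close>
    moreover have "(1 + real (Suc k) * s) * ?p \<le> (1 + s) ^ Suc k * ?p"
      using Bernoulli_inequality[of s "Suc k"] s p0 by (intro mult_right_mono) auto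
    ultimately have "s * (real (Suc k) * ?p) \<le> s * ((1 + s) ^ k * ?L)"
      by (simp add: algebra_simps)
    then show ?thesis using s by simp
  qed
  \<comment> \<open>The surplus factor \<open>(1 + s) ^ k\<close> disappears as \<open>s\<close>
    tends to 0 from the right.\<close>
  have "((\<lambda>s. (1 + s) ^ k * ?L) \<longlongrightarrow> (1 + 0) ^ k * ?L) (at_right 0)"
    by (intro tendsto_intros)
  moreover have "\<forall>\<^sub>F s in at_right 0. real (Suc k) * ?p \<le> (1 + s) ^ k * ?L"
    using eventually_at_right_real[OF i(2)] by eventually_elim (use * in auto)
  ultimately show ?thesis
    by (rule tendsto_lowerbound[THEN order_trans]) auto
qed

lemma edge_poly_support:
  assumes "finite E" "\<And>e. e \<in> E \<Longrightarrow> finite e" "\<And>e i. e \<in> E \<Longrightarrow> i \<in> e \<Longrightarrow> i \<notin> S \<Longrightarrow> x i = 0"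
  shows "edge_poly {e \<in> E. e \<subseteq> S} x = edge_poly E x"
  unfolding edge_poly_def
proof (rule sum.mono_neutral_left)
  show "\<forall>e\<in>E - {e \<in> E. e \<subseteq> S}. (\<Prod>i\<in>e. x i) = 0"
    using assms(2,3) by (auto simp: prod_zero_iff)
qed (use assms in auto)

text \<open>Since \<open>c * (1 - t)\<^sup>2\<close> does not increase for \<open>t\<close> up to 1,
  a lower bound on a link weight turns into an upper bound on the weight of its vertex.\<close>

lemma less_of_square_bound:
  fixes a c x b :: real
  assumes "b < c * (1 - x)\<^sup>2" "c * (1 - a)\<^sup>2 \<le> b" "0 \<le> c" "a \<le> 1" "x \<le> 1"
  shows "x < a"
proof (rule ccontr)
  assume "\<not> x < a"
  then have "(1 - x)\<^sup>2 \<le> (1 - a)\<^sup>2" using assms by (intro power_mono) auto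
  then have "c * (1 - x)\<^sup>2 \<le> c * (1 - a)\<^sup>2" using assms(3) by (rule mult_left_mono)
  with assms show False by linarith
qed

lemma link_weight_le:
  assumes "finite V" "E \<subseteq> [V]\<^bsup>3\<^esup>" "\<And>i. i \<in> V \<Longrightarrow> 0 \<le> x i" "sum x V = 1" "i \<in> V"
    and "0 < r" "clique_free (Suc r) (link E i)"
  shows "edge_poly (link E i) x \<le> (1 - 1 / real r) / 2 * (1 - x i)\<^sup>2"
proof -
  have "edge_poly (link E i) x \<le> (1 - 1 / real r) / 2 * (sum x (V - {i}))\<^sup>2"
    using assms link_nsets[of E V 2 i] by (intro motzkin_straus) (auto simp: numeral_3_eq_3 numeral_2_eq_2)
  then show ?thesis using assms by (simp add: sum_diff1)
qed

section \<open>Critical weightings of intersecting 3-graphs\<close>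

text \<open>\<open>pos\<close> and \<open>crit\<close> record what is used of a maximiser after
  restriction to its support.\<close>

lemma edge_poly_intersecting_le:
  assumes fV: "finite V" and EV: "E \<subseteq> [V]\<^bsup>3\<^esup>" and pos: "\<And>i. i \<in> V \<Longrightarrow> 0 < x i" and sum1: "sum x V = 1"
    and int: "intersecting E" and nK5: "\<not> is_complete_r_graph 5 3 E"
    and crit: "\<And>i. i \<in> V \<Longrightarrow> 3 * edge_poly E x \<le> edge_poly (link E i) x"
  shows "edge_poly E x \<le> 79 / 1000"
proof (rule ccontr)
  assume "\<not> ?thesis"
  then have big: "79 / 1000 < edge_poly E x" by simp
  then have L: "237 / 1000 < edge_poly (link E i) x" if "i \<in> V" for i using crit[OF that] by simp
  note E = nsets_finite_edges[OF fV EV]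
  have nn: "0 \<le> x i" if "i \<in> V" for i using pos[OF that] by simp
  have lk: "link E i \<subseteq> [V - {i}]\<^bsup>2\<^esup>" for i
    using link_nsets[of E V 2 i] EV by (simp add: numeral_3_eq_3 numeral_2_eq_2)
  have flk: "finite (link E i)" for i
    using nsets_finite_edges(1)[OF _ lk] fV by simp
  have le1: "x i \<le> 1" if "i \<in> V" for i
    using member_le_sum[of i V x] that nn fV sum1 by auto
  \<comment> \<open>Each \<open>a\<close> used below is
    \<open>1 - sqrt (0.474 / (1 - 1 / r))\<close> rounded up: 0.03, 0.157 and 0.206 for
    \<open>r\<close> = 2, 3, 4.\<close>
  have bound: "x i < a"
    if "i \<in> V" "clique_free (Suc r) (link E i)" "0 < r" "(1 - 1 / real r) / 2 * (1 - a)\<^sup>2 \<le> 237 / 1000" "a \<le> 1"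
    for i r a
  proof (rule less_of_square_bound)
    show "237 / 1000 < (1 - 1 / real r) / 2 * (1 - x i)\<^sup>2"
      by (rule less_le_trans[OF L[OF that(1)] link_weight_le[OF fV EV nn sum1 that(1) that(3,2)]])
  qed (use that le1 in auto)
  \<comment> \<open>The limit of large \<open>r\<close>: every link is free of cliques larger than
    \<open>V\<close>, so the coefficient is at most 1/2, and 0.312 is \<open>1 - sqrt 0.474\<close>
    rounded up.\<close>
  have xmax: "x i < 312 / 1000" if "i \<in> V" for i
  proof (rule less_of_square_bound)
    have "card V \<noteq> 0" using that fV by auto
    moreover have "clique_free (Suc (card V)) (link E i)"
    proof (rule clique_free_of_card[OF _ lk])
      show "card (V - {i}) < Suc (card V)" using card_Diff1_le[of V i] by simp
      show "2 \<le> Suc (card V)" using \<open>card V \<noteq> 0\<close> by linarith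
    qed (use fV in auto)
    ultimately have "edge_poly (link E i) x \<le> (1 - 1 / real (card V)) / 2 * (1 - x i)\<^sup>2"
      using that by (intro link_weight_le[OF fV EV nn sum1]) auto
    also have "\<dots> \<le> 1 / 2 * (1 - x i)\<^sup>2" by (intro mult_right_mono) auto
    finally show "237 / 1000 < 1 / 2 * (1 - x i)\<^sup>2" using L[OF that] by simp
  qed (use le1[OF that] in \<open>auto simp: power2_eq_square\<close>)
  \<comment> \<open>Pairs in the link of \<open>j\<close> through \<open>i\<close> weigh at most
    \<open>x i * (1 - x i)\<close>, because the partner of \<open>i\<close> lies in
    \<open>V - {i}\<close>.\<close>
  have codeg: "237 / 1000 < x i * (1 - x i) + edge_poly {f \<in> link E j. i \<notin> f} x"
    if "i \<in> V" "j \<in> V" "i \<noteq> j" for i j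
  proof -
    have finf: "finite f" if "f \<in> link E j" for f
      using lk that by (auto simp: nsets_def)
    have "link (link E j) i \<subseteq> [V - {j} - {i}]\<^bsup>Suc 0\<^esup>"
      using link_nsets[of "link E j" "V - {j}" "Suc 0" i] lk[of j] by (simp add: numeral_2_eq_2)
    then have "link (link E j) i \<subseteq> (\<lambda>u. {u}) ` (V - {i})"
      unfolding nsets_one by blast
    then have "edge_poly (link (link E j) i) x \<le> edge_poly ((\<lambda>u. {u}) ` (V - {i})) x"
      using fV nn by (intro edge_poly_mono) auto
    then have "x i * edge_poly (link (link E j) i) x \<le> x i * (1 - x i)"
      using nn[OF that(1)] fV that(1) sum1 
      by (intro mult_left_mono) (auto simp: edge_poly_singletons sum_diff1)
    then show ?thesis
      using L[OF that(2)] edge_poly_split[OF flk, of j x "\<lambda>f. i \<in> f"]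
        edge_poly_link[OF flk finf, of j x i] by simp
  qed
  \<comment> \<open>A pair \<open>g\<close> inside \<open>C - f\<close> would make
    \<open>insert i g\<close> and \<open>insert j f\<close> disjoint edges.\<close>
  have cross: "[C - f]\<^bsup>2\<^esup> = {}"
    if "i \<noteq> j" "[C]\<^bsup>2\<^esup> \<subseteq> link E i" "j \<notin> C" "f \<in> link E j" "i \<notin> f" for i j C f
  proof (rule ccontr)
    assume "[C - f]\<^bsup>2\<^esup> \<noteq> {}"
    then obtain g where g: "g \<subseteq> C - f" "finite g" "card g = 2" by (auto simp: nsets_def)
    then have "g \<in> link E i" using that(2) by (auto simp: nsets_def)
    then have "insert i g \<in> E" "insert j f \<in> E" using that(4) by (auto simp: link_def)
    then have "insert i g \<inter> insert j f \<noteq> {}" using int unfolding intersecting_def by blast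
    with that g show False by auto
  qed
  have K4: "clique_free 4 (link E i)" if i: "i \<in> V" for i
    unfolding clique_free_def
  proof safe
    fix C assume C: "finite C" "card C = 4" "[C]\<^bsup>2\<^esup> \<subseteq> link E i"
    have CV: "C \<subseteq> V - {i}" using clique_vertices[OF lk C(3)] C(2) by simp
    have "V \<subseteq> insert i C"
    proof (rule ccontr)
      assume "\<not> ?thesis"
      then obtain j where j: "j \<in> V" "j \<noteq> i" "j \<notin> C" by auto
      \<comment> \<open>A pair covers at most two of the four vertices of \<open>C\<close>, leaving
        a pair that \<open>cross\<close> forbids.\<close>
      have "{f \<in> link E j. i \<notin> f} = {}"
      proof safe
        fix f assume f: "f \<in> link E j" "i \<notin> f"
        have "card f = 2" "finite f" using lk f by (auto simp: nsets_def)
        then have "2 \<le> card (C - f)" using C diff_card_le_card_Diff[of f C] by simp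
        then obtain g where "g \<subseteq> C - f" "card g = 2" "finite g"
          using obtain_subset_with_card_n by metis
        then have "[C - f]\<^bsup>2\<^esup> \<noteq> {}" by (auto simp: nsets_def)
        with cross[OF _ C(3) j(3) f] j show "f \<in> {}" by auto
      qed
      then have "edge_poly {f \<in> link E j. i \<notin> f} x = 0"
        by (simp only: edge_poly_def sum.empty)
      then have "237 / 1000 < x i * (1 - x i)" using codeg[OF i j(1)] j by simp
      \<comment> \<open>As 0.312 + 0.688 = 1, expanding gives \<open>x i * (1 - x i)\<close> at most
        0.312 * 0.688 < 0.215, below 0.237.\<close>
      moreover have "0 \<le> (312 / 1000 - x i) * (688 / 1000 - x i)"
        using xmax[OF i] by (intro mult_nonneg_nonneg) auto
      ultimately show False by (simp add: algebra_simps)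
    qed
    then have V: "V = insert i C" using CV i by blast
    have cV: "card V = 5" unfolding V using C(1,2) CV by (subst card_insert_disjoint) auto
    then have "E \<noteq> [V]\<^bsup>3\<^esup>" using nK5 fV by (auto simp: is_complete_r_graph_def)
    then obtain t where t: "t \<subseteq> V" "card t = 3" "finite t" "t \<notin> E" using EV by (auto simp: nsets_def)
    \<comment> \<open>A \<open>K_4\<close> in the link of \<open>u\<close> would fill
      \<open>V - {u}\<close> and hence contain \<open>t - {u}\<close>, making \<open>t\<close> an
      edge.\<close>
    have "x u \<le> 157 / 1000" if u: "u \<in> t" for u
    proof -
      have "clique_free (Suc 3) (link E u)"
        unfolding clique_free_def
      proof safe
        fix D assume D: "finite D" "card D = Suc 3" "[D]\<^bsup>2\<^esup> \<subseteq> link E u"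
        have "D \<subseteq> V - {u}" using clique_vertices[OF lk D(3)] D(2) by simp
        moreover have "card D = card (V - {u})" using D(2) cV u t by auto
        ultimately have "D = V - {u}" using fV card_subset_eq finite_Diff by metis
        then have "t - {u} \<in> [D]\<^bsup>2\<^esup>" using t u by (auto simp: nsets_def)
        then have "t - {u} \<in> link E u" using D(3) by blast
        then show False using t u by (auto simp: link_def insert_absorb)
      qed
      then have "x u < 157 / 1000"
        by (rule bound[rotated]) (use u t in \<open>auto simp: power2_eq_square\<close>)
      then show ?thesis by simp
    qed
    then have "sum x t \<le> real (card t) * (157 / 1000)" by (rule sum_bounded_above)
    \<comment> \<open>Links have only four possible vertices, so they are \<open>K_5\<close>-free.
      The total is then at most 3 * 0.157 + 2 * 0.206 = 0.883.\<close>
    moreover have "x u \<le> 206 / 1000" if u: "u \<in> V - t" for u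
    proof -
      have "clique_free (Suc 4) (link E u)"
        using clique_free_of_card[OF _ lk, of u 5] fV cV u by simp
      then have "x u < 206 / 1000"
        by (rule bound[rotated]) (use u in \<open>auto simp: power2_eq_square\<close>)
      then show ?thesis by simp
    qed
    then have "sum x (V - t) \<le> real (card (V - t)) * (206 / 1000)" by (rule sum_bounded_above)
    moreover have "sum x V = sum x (V - t) + sum x t"
      using fV t by (simp add: sum.subset_diff)
    moreover have "card (V - t) = 2" using t cV by (simp add: card_Diff_subset)
    ultimately show False using t sum1 by simp
  qed
  have small: "x i \<le> 157 / 1000" if "i \<in> V" for i
    using bound[OF that, of 3 "157 / 1000"] K4[OF that] by (simp add: power2_eq_square)
  have sums: "sum x C \<le> real (card C) * (157 / 1000)" if "C \<subseteq> V" for C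
    using that small by (intro sum_bounded_above) auto
  have K3: "clique_free 3 (link E i)" if i: "i \<in> V" for i
    unfolding clique_free_def
  proof safe
    fix C assume C: "finite C" "card C = 3" "[C]\<^bsup>2\<^esup> \<subseteq> link E i"
    have CV: "C \<subseteq> V - {i}" using clique_vertices[OF lk C(3)] C(2) by simp
    \<comment> \<open>Four vertices weigh at most 0.628, so a further vertex \<open>j\<close> must
      exist.\<close>
    have "card (insert i C) \<le> 4" using C CV by (simp add: card_insert_if)
    then have "real (card (insert i C)) * (157 / 1000) < 1" by linarith
    moreover have "insert i C \<subseteq> V" using CV i by blast
    ultimately have "sum x (insert i C) < 1" using sums by (meson le_less_trans)
    then have "insert i C \<noteq> V" using sum1 by auto
    then obtain j where j: "j \<in> V" "j \<noteq> i" "j \<notin> C" using CV i by blast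
    let ?F = "{f \<in> link E j. i \<notin> f}"
    \<comment> \<open>By \<open>cross\<close> a pair \<open>f\<close> misses at most one vertex of
      \<open>C\<close>, so both of its elements lie in \<open>C\<close>.\<close>
    have FC: "?F \<subseteq> [C]\<^bsup>2\<^esup>"
    proof safe
      fix f assume f: "f \<in> link E j" "i \<notin> f"
      have f2: "card f = 2" "finite f" using lk f by (auto simp: nsets_def)
      have "\<not> 2 \<le> card (C - f)"
      proof
        assume "2 \<le> card (C - f)"
        then obtain g where "g \<subseteq> C - f" "card g = 2" "finite g"
          using obtain_subset_with_card_n by metis
        then have "[C - f]\<^bsup>2\<^esup> \<noteq> {}" by (auto simp: nsets_def)
        with cross[OF _ C(3) j(3) f] j show False by auto
      qed
      moreover have "card C = card (C - f) + card (C \<inter> f)"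
        using C(1) by (simp add: card_Diff_subset_Int card_mono)
      ultimately have "card f \<le> card (C \<inter> f)" using C(2) f2 by simp
      then have "C \<inter> f = f" using f2 by (intro card_seteq) auto
      then show "f \<in> [C]\<^bsup>2\<^esup>" using f2 by (auto simp: nsets_def)
    qed
    have "clique_free (Suc 3) ?F"
      using clique_free_of_card[OF C(1) FC] C(2) by simp
    then have "edge_poly ?F x \<le> (1 - 1 / real 3) / 2 * (sum x C)\<^sup>2"
      using CV nn by (intro motzkin_straus[OF C(1) FC]) auto
    \<comment> \<open>Here 0.471 = 3 * 0.157, and 0.471 squared over 3 is just below 0.074. Hence
      \<open>x i * (1 - x i)\<close> exceeds 0.237 - 0.074 = 0.163, whereas \<open>x i\<close> at
      most 0.157 allows only 0.157 * 0.843 < 0.133.\<close>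
    also have "\<dots> \<le> (1 - 1 / real 3) / 2 * (471 / 1000)\<^sup>2"
      using sums[of C] CV C(2) nn by (intro mult_left_mono power_mono sum_nonneg) auto
    finally have "edge_poly ?F x \<le> (1 - 1 / real 3) / 2 * (471 / 1000)\<^sup>2" .
    then have "edge_poly ?F x \<le> 74 / 1000" by (simp add: power2_eq_square)
    then have "163 / 1000 < x i * (1 - x i)"
      using codeg[OF i j(1)] j by simp
    moreover have "0 \<le> (157 / 1000 - x i) * (843 / 1000 - x i)"
      using small[OF i] by (intro mult_nonneg_nonneg) auto
    ultimately show False by (simp add: algebra_simps)
  qed
  have tiny: "x i \<le> 3 / 100" if "i \<in> V" for i
    using bound[OF that, of 2 "3 / 100"] K3[OF that] by (simp add: power2_eq_square)
  have "E \<noteq> {}" using big by (auto simp: edge_poly_def)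
  then obtain e where e: "e \<in> E" by blast
  \<comment> \<open>Every edge meets \<open>e\<close>, so its three vertices bound everything: 3 *
    0.03 / 4 = 0.0225.\<close>
  have "edge_poly E x \<le> (\<Sum>i\<in>e. x i * edge_poly (link E i) x)"
  proof (rule edge_poly_le_sum_links)
    show "0 \<le> x i" if "f \<in> E" "i \<in> f" for f i using that E(3) nn by blast
    show "e \<inter> f \<noteq> {}" if "f \<in> E" for f using that e int unfolding intersecting_def by blast
  qed (use E e in auto)
  also have "\<dots> \<le> real (card e) * (3 / 100 * (1 / 4))"
  proof (intro sum_bounded_above mult_mono)
    fix i assume "i \<in> e"
    then have i: "i \<in> V" using E e by blast
    have "edge_poly (link E i) x \<le> (1 - 1 / real 2) / 2 * (1 - x i)\<^sup>2"
      using K3[OF i] by (intro link_weight_le[OF fV EV nn sum1 i]) auto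
    moreover have "(1 - x i)\<^sup>2 \<le> 1" using nn[OF i] le1[OF i] by (simp add: power_le_one)
    ultimately show "edge_poly (link E i) x \<le> 1 / 4" by simp
    show "0 \<le> edge_poly (link E i) x" using L[OF i] by simp
    show "x i \<le> 3 / 100" by (rule tiny[OF i])
  qed auto
  also have "\<dots> \<le> 79 / 1000" using E(4)[OF e] by simp
  finally show False using big by simp
qed

section \<open>From critical weightings to Lagrangians\<close>

text \<open>A maximiser is restricted to its support \<open>S\<close>, where all weights are
  positive; the discarded edges contribute zero.\<close>

lemma lagrangian_intersecting_le:
  assumes G: "r_graph 3 V E" and ne: "V \<noteq> {}" and int: "intersecting E"
    and nK5: "\<not> is_complete_r_graph 5 3 E"
  shows "lagrangian V E \<le> 79 / 1000"
proof -
  have fV: "finite V" and EV: "E \<subseteq> [V]\<^bsup>3\<^esup>" using G by (auto simp: r_graph_def)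
  note E = nsets_finite_edges[OF fV EV]
  obtain x where x: "x \<in> weightings V" "edge_poly E x = lagrangian V E"
    and max: "\<And>y. y \<in> weightings V \<Longrightarrow> edge_poly E y \<le> edge_poly E x"
    using lagrangian_is_max[OF G ne] by blast
  define S where "S = {i \<in> V. 0 < x i}"
  define F where "F = {e \<in> E. e \<subseteq> S}"
  have zero: "x i = 0" if "i \<in> V" "i \<notin> S" for i
    using that x(1) by (force simp: S_def weightings_def)
  have fS: "finite S" using fV by (simp add: S_def)
  have pF: "edge_poly F x = edge_poly E x"
    unfolding F_def using E zero by (intro edge_poly_support) blast+
  have "edge_poly F x \<le> 79 / 1000"
  proof (rule edge_poly_intersecting_le[OF fS])
    show "F \<subseteq> [S]\<^bsup>3\<^esup>" using EV by (auto simp: F_def nsets_def)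
    show "0 < x i" if "i \<in> S" for i using that by (simp add: S_def)
    have "sum x V = sum x S"
      using zero fV by (intro sum.mono_neutral_right) (auto simp: S_def)
    then show "sum x S = 1" using x(1) by (simp add: weightings_def)
    show "intersecting F" using int by (auto simp: F_def intersecting_def)
    show "\<not> is_complete_r_graph 5 3 F"
    proof
      assume "is_complete_r_graph 5 3 F"
      then obtain T where T: "finite T" "card T = 5" "F = [T]\<^bsup>3\<^esup>"
        by (auto simp: is_complete_r_graph_def)
      \<comment> \<open>Restriction cannot create a new \<open>K_5^3\<close>: an edge not inside
        \<open>T\<close> leaves at least three vertices of \<open>T\<close> uncovered, which form an
        edge of \<open>F\<close> disjoint from it.\<close>
      have "e \<in> F" if e: "e \<in> E" for e
      proof (rule ccontr)
        assume "e \<notin> F"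
        then have "\<not> e \<subseteq> T" using e E T by (auto simp: nsets_def)
        then have "card (T \<inter> e) < card e" using E(2)[OF e] by (intro psubset_card_mono) auto
        then have "3 \<le> card (T - e)"
          using E(4)[OF e] T by (simp add: card_Diff_subset_Int)
        then obtain g where "g \<subseteq> T - e" "card g = 3" "finite g"
          using obtain_subset_with_card_n by metis
        then have "g \<in> F" "g \<inter> e = {}" using T by (auto simp: nsets_def)
        then show False using int e by (auto simp: F_def intersecting_def)
      qed
      then have "E = F" by (auto simp: F_def)
      with T nK5 show False by (auto simp: is_complete_r_graph_def)
    qed
    fix i assume "i \<in> S"
    then have i: "i \<in> V" "0 < x i" "i \<in> S" by (auto simp: S_def)
    have lk: "link E i \<subseteq> [V - {i}]\<^bsup>2\<^esup>"
      using link_nsets[of E V 2 i] EV by (simp add: numeral_3_eq_3 numeral_2_eq_2)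
    \<comment> \<open>Only pairs of weight zero leave the link, so the first-order condition passes
      from \<open>E\<close> to \<open>F\<close>.\<close>
    have "link F i = {f \<in> link E i. f \<subseteq> S}" using i by (auto simp: link_def F_def)
    also have "edge_poly \<dots> x = edge_poly (link E i) x"
      using nsets_finite_edges[OF _ lk] fV zero by (intro edge_poly_support) blast+
    finally show "3 * edge_poly F x \<le> edge_poly (link F i) x"
      using maximizer_link_ge[of V E 2 x i] fV EV x(1) max i pF by (simp add: numeral_3_eq_3)
  qed
  then show ?thesis using pF x(2) by simp
qed

text \<open>The same method is exact here: links have four vertices and 3/8 * (4/5)^2 = 6/25 = 3 *
  2/25, so a larger maximum would force all five weights below 1/5.\<close>

lemma lagrangian_K5:
  "lagrangian {1..5::nat} ([{1..5::nat}]\<^bsup>3\<^esup>) = 2 / 25"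
proof -
  let ?V = "{1..5::nat}" and ?E = "[{1..5::nat}]\<^bsup>3\<^esup>"
  have G: "r_graph 3 ?V ?E" by (simp add: r_graph_def)
  have "?V \<noteq> {}" by simp
  from lagrangian_is_max[OF G this]
  obtain x where x: "x \<in> weightings ?V" "edge_poly ?E x = lagrangian ?V ?E"
    and max: "\<And>y. y \<in> weightings ?V \<Longrightarrow> edge_poly ?E y \<le> edge_poly ?E x"
    by blast
  have nn: "\<And>i. i \<in> ?V \<Longrightarrow> 0 \<le> x i" and sum1: "sum x ?V = 1" using x by (auto simp: weightings_def)
  have "edge_poly ?E x \<le> 2 / 25"
  proof (rule ccontr)
    assume big: "\<not> ?thesis"
    have "x i < 1 / 5" if i: "i \<in> ?V" for i
    proof (cases "0 < x i")
      case True
      have "clique_free (Suc 4) (link ?E i)"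
        using clique_free_of_card[OF _ link_nsets[of ?E ?V 2 i], of 5] i
        by (simp add: numeral_3_eq_3 numeral_2_eq_2)
      then have "edge_poly (link ?E i) x \<le> (1 - 1 / real 4) / 2 * (1 - x i)\<^sup>2"
        using i by (intro link_weight_le[OF _ _ nn sum1]) auto
      moreover have "3 * edge_poly ?E x \<le> edge_poly (link ?E i) x"
        using maximizer_link_ge[of ?V ?E 2 x i] x(1) max i True by (simp add: numeral_3_eq_3)
      ultimately have "6 / 25 < 3 / 8 * (1 - x i)\<^sup>2" using big by simp
      moreover have "3 / 8 * (1 - 1 / 5)\<^sup>2 \<le> (6 / 25 :: real)" by (simp add: power2_eq_square)
      moreover have "x i \<le> 1"
        using member_le_sum[of i ?V x] i nn sum1 by auto
      ultimately show ?thesis using less_of_square_bound[of "6 / 25" "3 / 8" "x i" "1 / 5"] by simp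
    qed simp
    then have "sum x ?V < (\<Sum>i\<in>?V. 1 / 5)" by (intro sum_strict_mono) auto
    then show False using sum1 by simp
  qed
  moreover have "2 / 25 \<le> edge_poly ?E x"
  proof -
    \<comment> \<open>Uniform weights attain the value: ten edges of weight 1/125.\<close>
    have "edge_poly ?E (\<lambda>i. 1 / 5) = (\<Sum>e\<in>?E. (1 / 5) ^ 3)"
      unfolding edge_poly_def by (intro sum.cong) (auto simp: nsets_def)
    also have "\<dots> = 2 / 25" by (simp add: card_nsets binomial_fact fact_numeral power3_eq_cube)
    finally show ?thesis using max[of "\<lambda>i. 1 / 5"] by (simp add: weightings_def)
  qed
  ultimately show ?thesis using x(2) by simp
qed

theorem theorem1p2:
  fixes V :: "'a set" and E :: "'a set set"
  assumes "r_graph 3 V E"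
    and "V \<noteq> {}"
    and "intersecting E"
    and "\<not> is_complete_r_graph 5 3 E"
  shows "lagrangian V E \<le> lagrangian {1..5::nat} ([{1..5::nat}]\<^bsup>3\<^esup>) - 1 / 10 ^ 3 \<and>
         lagrangian {1..5::nat} ([{1..5::nat}]\<^bsup>3\<^esup>) = 2 / 25"
  using lagrangian_intersecting_le[OF assms] lagrangian_K5 by simp

end
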